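(* Let $\vec U$ be a finite distributive universe of separations and let $\vec S\subseteq\vec U$ be a subsystem which is submodular in $\vec U$. Then $\vec S$ is a disjoint union of corner-closed subsystems $\vec S_1,\dots,\vec S_n$ of $\vec S$ in $\vec U$ (which are thus also submodular in $\vec U$), each of which can be corner-faithfully embedded into a universe of bipartitions. Specifically, these subsystems are the equivalence classes of the relation $\sim$ on $\vec S$ given by $s\sim t$ if and only if $s\wedge s^*=t\wedge t^*$ in $\vec U$.
   Context: A separation system is a poset with an order-reversing involution ${}^*$. A universe of separations is a separation system $\vec U$ whose poset is a lattice; it is distributive if the lattice is distributive. A subsystem of a separation system is a subset closed under the involution, with restricted order and involution. A subsystem $\vec S$ of $\vec U$ is submodular in $\vec U$ if for all $r,s\in\vec S$ at least one of $r\vee s$, $r\wedge s$ (taken in $\vec U$) lies in $\vec S$. For a subsystem $\vec S\subseteq\vec U$, a subsystem $\vec S'\subseteq\vec S$ is a corner-closed subsystem of $\vec S$ (in $\vec U$) if for all $r,s\in\vec S'$ we have $r\vee s\in\vec S'$ whenever $r\vee s\in\vec S$. For a set $V$, the bipartition universe $\mathcal B(V)$ (a universe of bipartitions) is the lattice of all subsets of $V$ ordered by inclusion with involution $A^*=V\setminus A$. A corner-faithful embedding of a subsystem $\vec T$ of a universe $\vec U$ into a universe $\vec U'$ is an isomorphism of separation systems (a bijection which, together with its inverse, preserves $\le$, and which commutes with ${}^*$) $\iota\colon\vec T\to\vec T'$ onto a subsystem $\vec T'\subseteq\vec U'$ such that for all $r,s\in\vec T$: $\iota(r)\vee\iota(s)=\iota(r\vee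 s)$ whenever $r\vee s\in\vec T$, and $\iota(r)\wedge\iota(s)=\iota(r\wedge s)$ whenever $r\wedge s\in\vec T$, where joins and meets are taken in $\vec U$ and $\vec U'$ respectively. *)

theory Defs
  imports "HOL-Algebra.Lattice" "HOL-Library.Disjoint_Sets"
begin

record 'a sep_system = "'a gorder" +
  invol :: "'a \<Rightarrow> 'a"

locale separation_system = partial_order U for U (structure) +
  assumes invol_closed: "x \<in> carrier U \<Longrightarrow> invol U x \<in> carrier U"
    and invol_invol: "x \<in> carrier U \<Longrightarrow> invol U (invol U x) = x"
    and invol_antimono: "\<lbrakk>x \<in> carrier U; y \<in> carrier U; x \<sqsubseteq> y\<rbrakk> \<Longrightarrow> invol U y \<sqsubseteq> invol U x"

locale sep_universe = separation_system U + lattice U for U (structure)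

locale distributive_sep_universe = sep_universe U for U (structure) +
  assumes meet_join_distrib:
    "\<lbrakk>x \<in> carrier U; y \<in> carrier U; z \<in> carrier U\<rbrakk> \<Longrightarrow> x \<sqinter> (y \<squnion> z) = (x \<sqinter> y) \<squnion> (x \<sqinter> z)"

text \<open>
  A subsystem is represented by its underlying set; joins and meets of its elements are always
  those of the ambient universe. A subsystem of a subsystem \<open>S\<close> of \<open>U\<close> is a
  subsystem of \<open>U\<close> that is contained in \<open>S\<close>.
\<close>

definition subsystem :: "'a set \<Rightarrow> 'a sep_system \<Rightarrow> bool" where
  "subsystem S U \<longleftrightarrow> S \<subseteq> carrier U \<and> (\<forall>s\<in>S. invol U s \<in> S)"

definition induced_system :: "'a sep_system \<Rightarrow> 'a set \<Rightarrow> 'a sep_system" where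
  "induced_system U S = U\<lparr>carrier := S\<rparr>"

definition submodular_in :: "'a set \<Rightarrow> 'a sep_system \<Rightarrow> bool" where
  "submodular_in S U \<longleftrightarrow> subsystem S U \<and>
     (\<forall>r\<in>S. \<forall>s\<in>S. r \<squnion>\<^bsub>U\<^esub> s \<in> S \<or> r \<sqinter>\<^bsub>U\<^esub> s \<in> S)"

text \<open>Closure under the meets that lie in \<open>S\<close> follows by applying the involution.\<close>

definition corner_closed_subsystem :: "'a set \<Rightarrow> 'a set \<Rightarrow> 'a sep_system \<Rightarrow> bool" where
  "corner_closed_subsystem S' S U \<longleftrightarrow> subsystem S U \<and> subsystem S' U \<and> S' \<subseteq> S \<and>
     (\<forall>r\<in>S'. \<forall>s\<in>S'. r \<squnion>\<^bsub>U\<^esub> s \<in> S \<longrightarrow> r \<squnion>\<^bsub>U\<^esub> s \<in> S')"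

definition sep_iso :: "'a sep_system \<Rightarrow> 'b sep_system \<Rightarrow> ('a \<Rightarrow> 'b) \<Rightarrow> bool" where
  "sep_iso A B f \<longleftrightarrow> bij_betw f (carrier A) (carrier B) \<and>
     (\<forall>x\<in>carrier A. \<forall>y\<in>carrier A. x \<sqsubseteq>\<^bsub>A\<^esub> y \<longleftrightarrow> f x \<sqsubseteq>\<^bsub>B\<^esub> f y) \<and>
     (\<forall>x\<in>carrier A. f (invol A x) = invol B (f x))"

definition corner_faithful_embedding ::
  "'a sep_system \<Rightarrow> 'a set \<Rightarrow> 'b sep_system \<Rightarrow> ('a \<Rightarrow> 'b) \<Rightarrow> bool" where
  "corner_faithful_embedding U T U' f \<longleftrightarrow>
     (\<exists>T'. subsystem T' U' \<and> sep_iso (induced_system U T) (induced_system U' T') f) \<and>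
     (\<forall>r\<in>T. \<forall>s\<in>T. r \<squnion>\<^bsub>U\<^esub> s \<in> T \<longrightarrow> f r \<squnion>\<^bsub>U'\<^esub> f s = f (r \<squnion>\<^bsub>U\<^esub> s)) \<and>
     (\<forall>r\<in>T. \<forall>s\<in>T. r \<sqinter>\<^bsub>U\<^esub> s \<in> T \<longrightarrow> f r \<sqinter>\<^bsub>U'\<^esub> f s = f (r \<sqinter>\<^bsub>U\<^esub> s))"

text \<open>
  The set \<open>V\<close> may be empty; the bipartition universe then has a single, self-inverse
  element.
\<close>

definition bipartition_universe :: "'v set \<Rightarrow> 'v set sep_system" where
  "bipartition_universe V =
     \<lparr>carrier = Pow V, eq = (=), le = (\<subseteq>), invol = (\<lambda>A. V - A)\<rparr>"

definition same_bottom_rel :: "'a sep_system \<Rightarrow> 'a set \<Rightarrow> 'a rel" where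
  "same_bottom_rel U S =
     {(s, t). s \<in> S \<and> t \<in> S \<and> s \<sqinter>\<^bsub>U\<^esub> invol U s = t \<sqinter>\<^bsub>U\<^esub> invol U t}"

lemma separation_system_induced:
  assumes "separation_system U" "subsystem S U"
  shows "separation_system (induced_system U S)"
proof -
  interpret separation_system U by fact
  have S: "S \<subseteq> carrier U" "\<And>s. s \<in> S \<Longrightarrow> invol U s \<in> S"
    using assms(2) by (auto simp: subsystem_def)
  show ?thesis
    by unfold_locales
      (use S in \<open>auto simp: induced_system_def eq_is_equal invol_invol subset_iff
        intro: le_trans invol_antimono\<close>)
qed

lemma bipartition_universe_partial_order: "partial_order (bipartition_universe V)"
  by unfold_locales (auto simp: bipartition_universe_def)

lemma least_bipartition:
  assumes "A \<subseteq> V" "B \<subseteq> V"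
  shows "least (bipartition_universe V) (A \<union> B) (Upper (bipartition_universe V) {A, B})"
  using assms by (auto simp: least_def Upper_def bipartition_universe_def)

lemma greatest_bipartition:
  assumes "A \<subseteq> V" "B \<subseteq> V"
  shows "greatest (bipartition_universe V) (A \<inter> B) (Lower (bipartition_universe V) {A, B})"
  using assms by (auto simp: greatest_def Lower_def bipartition_universe_def)

lemma join_bipartition:
  assumes "A \<subseteq> V" "B \<subseteq> V"
  shows "A \<squnion>\<^bsub>bipartition_universe V\<^esub> B = A \<union> B"
proof -
  interpret partial_order "bipartition_universe V" by (rule bipartition_universe_partial_order)
  show ?thesis
    unfolding join_def sup_def
    by (rule some_equality) (use least_bipartition[OF assms] least_unique in auto)
qed

lemma meet_bipartition:
  assumes "A \<subseteq> V" "B \<subseteq> V"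
  shows "A \<sqinter>\<^bsub>bipartition_universe V\<^esub> B = A \<inter> B"
proof -
  interpret partial_order "bipartition_universe V" by (rule bipartition_universe_partial_order)
  show ?thesis
    unfolding meet_def inf_def
    by (rule some_equality) (use greatest_bipartition[OF assms] greatest_unique in auto)
qed

lemma distributive_bipartition_universe:
  "distributive_sep_universe (bipartition_universe V)"
proof -
  interpret partial_order "bipartition_universe V" by (rule bipartition_universe_partial_order)
  have carr: "carrier (bipartition_universe V) = Pow V"
    by (simp add: bipartition_universe_def)
  show ?thesis
  proof unfold_locales
    fix x y assume "x \<in> carrier (bipartition_universe V)" "y \<in> carrier (bipartition_universe V)"
    then show "\<exists>s. least (bipartition_universe V) s (Upper (bipartition_universe V) {x, y})"
      "\<exists>s. greatest (bipartition_universe V) s (Lower (bipartition_universe V) {x, y})"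
      using least_bipartition greatest_bipartition unfolding carr by blast+
  next
    fix x y z
    assume "x \<in> carrier (bipartition_universe V)" "y \<in> carrier (bipartition_universe V)"
      "z \<in> carrier (bipartition_universe V)"
    then have V: "x \<subseteq> V" "y \<subseteq> V" "z \<subseteq> V" "x \<inter> y \<subseteq> V" "x \<inter> z \<subseteq> V" "y \<union> z \<subseteq> V"
      unfolding carr by auto
    show "x \<sqinter>\<^bsub>bipartition_universe V\<^esub> (y \<squnion>\<^bsub>bipartition_universe V\<^esub> z) =
      (x \<sqinter>\<^bsub>bipartition_universe V\<^esub> y) \<squnion>\<^bsub>bipartition_universe V\<^esub> (x \<sqinter>\<^bsub>bipartition_universe V\<^esub> z)"
      by (simp add: join_bipartition meet_bipartition V Int_Un_distrib)
  qed (auto simp: bipartition_universe_def)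
qed

end

theory Submission
  imports Defs
begin

text \<open>
  For fixed \<open>c\<close>, the elements \<open>x\<close> with \<open>x \<sqinter> x\<^sup>* = c\<close> form a sublattice closed under
  the involution. All of it lies between \<open>c\<close> and \<open>c\<^sup>*\<close>, and there the involution is a
  complementation: \<open>x \<sqinter> x\<^sup>* = c\<close> and \<open>x \<squnion> x\<^sup>* = c\<^sup>*\<close>. So this fibre is a finite Boolean
  algebra, and sending \<open>x\<close> to the set of atoms below it embeds the fibre, hence each
  equivalence class, into the bipartitions of the set of atoms.
\<close>

text \<open>The fibre is taken in all of \<open>carrier U\<close> rather than in \<open>S\<close>:
  in a distributive universe it is then closed under joins and meets, which a class in
  \<open>S\<close> need not be.\<close>

definition fibre :: "('a, 'b) sep_system_scheme \<Rightarrow> 'a \<Rightarrow> 'a set" where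
  "fibre U c = {x \<in> carrier U. x \<sqinter>\<^bsub>U\<^esub> invol U x = c}"

definition fibre_atoms :: "('a, 'b) sep_system_scheme \<Rightarrow> 'a \<Rightarrow> 'a set" where
  "fibre_atoms U c =
     {a \<in> fibre U c. a \<noteq> c \<and> (\<forall>x \<in> fibre U c. x \<sqsubseteq>\<^bsub>U\<^esub> a \<longrightarrow> x = a \<or> x = c)}"

definition atoms_below :: "('a, 'b) sep_system_scheme \<Rightarrow> 'a \<Rightarrow> 'a \<Rightarrow> 'a set" where
  "atoms_below U c x = {a \<in> fibre_atoms U c. a \<sqsubseteq>\<^bsub>U\<^esub> x}"

lemma equiv_same_bottom_rel: "equiv S (same_bottom_rel U S)"
  by (auto simp: same_bottom_rel_def intro!: equivI refl_onI symI transI)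

text \<open>Passes from classes to fibres: for the class of \<open>s\<close>, the element
  \<open>c\<close> is \<open>s \<sqinter> invol U s\<close>.\<close>

lemma quotient_same_bottom_rel:
  assumes "subsystem S U" and "C \<in> S // same_bottom_rel U S"
  obtains c where "C = S \<inter> fibre U c"
proof -
  obtain s where "s \<in> S" "C = same_bottom_rel U S `` {s}"
    using assms(2) by (auto elim: quotientE)
  then have "C = S \<inter> fibre U (s \<sqinter>\<^bsub>U\<^esub> invol U s)"
    using assms(1) by (auto simp: same_bottom_rel_def fibre_def subsystem_def)
  then show ?thesis by (rule that)
qed

section \<open>De Morgan laws and the bounds of a fibre\<close>

context sep_universe
begin

text \<open>De Morgan. One inequality is antitonicity. For the other, the involution turns the two
  lower bounds of \<open>invol U x \<sqinter> invol U y\<close> into upper bounds, so the involute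
  of this meet lies above \<open>x\<close> and \<open>y\<close>, hence above their join.\<close>

lemma invol_join:
  assumes "x \<in> carrier U" "y \<in> carrier U"
  shows "invol U (x \<squnion> y) = invol U x \<sqinter> invol U y"
proof (rule le_antisym)
  show "invol U (x \<squnion> y) \<sqsubseteq> invol U x \<sqinter> invol U y"
    using assms by (intro meet_le invol_antimono join_left join_right) (auto simp: invol_closed)
  have "x \<sqsubseteq> invol U (invol U x \<sqinter> invol U y)"
    using invol_antimono[OF _ _ meet_left, of "invol U x" "invol U y"] assms
    by (simp add: invol_closed invol_invol)
  moreover have "y \<sqsubseteq> invol U (invol U x \<sqinter> invol U y)"
    using invol_antimono[OF _ _ meet_right, of "invol U x" "invol U y"] assms
    by (simp add: invol_closed invol_invol)
  ultimately have "x \<squnion> y \<sqsubseteq> invol U (invol U x \<sqinter> invol U y)"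
    using assms by (intro join_le) (auto simp: invol_closed)
  then show "invol U x \<sqinter> invol U y \<sqsubseteq> invol U (x \<squnion> y)"
    using invol_antimono[of "x \<squnion> y" "invol U (invol U x \<sqinter> invol U y)"] assms
    by (simp add: invol_closed invol_invol)
qed (use assms in \<open>auto simp: invol_closed\<close>)

lemma invol_meet:
  assumes "x \<in> carrier U" "y \<in> carrier U"
  shows "invol U (x \<sqinter> y) = invol U x \<squnion> invol U y"
proof -
  have "invol U (invol U x \<squnion> invol U y) = x \<sqinter> y"
    using assms by (simp add: invol_join invol_closed invol_invol)
  then have "invol U (x \<sqinter> y) = invol U (invol U (invol U x \<squnion> invol U y))" by simp
  then show ?thesis using assms by (simp add: invol_closed invol_invol)
qed

lemma meet_eq_of_le:
  assumes "x \<in> carrier U" "y \<in> carrier U" "x \<sqsubseteq> y"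
  shows "x \<sqinter> y = x"
  using le_iff_join assms by simp

lemma fibre_carrier: "x \<in> fibre U c \<Longrightarrow> x \<in> carrier U"
  by (simp add: fibre_def)

lemma fibre_meet_invol: "x \<in> fibre U c \<Longrightarrow> x \<sqinter> invol U x = c"
  by (simp add: fibre_def)

lemma fibre_bottom_carrier: "x \<in> fibre U c \<Longrightarrow> c \<in> carrier U"
  by (auto simp: fibre_def invol_closed)

lemma invol_fibre: "x \<in> fibre U c \<Longrightarrow> invol U x \<in> fibre U c"
  by (auto simp: fibre_def invol_closed invol_invol meet_comm)

lemma fibre_bottom_le: "x \<in> fibre U c \<Longrightarrow> c \<sqsubseteq> x"
  using meet_left by (auto simp: fibre_def invol_closed)

text \<open>The dual half of complementation: De Morgan applied to
  \<open>x \<sqinter> invol U x = c\<close>.\<close>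

lemma fibre_join_invol:
  assumes "x \<in> fibre U c"
  shows "x \<squnion> invol U x = invol U c"
proof -
  have "invol U c = invol U (x \<sqinter> invol U x)"
    by (simp only: fibre_meet_invol[OF assms])
  also have "\<dots> = x \<squnion> invol U x"
    using fibre_carrier[OF assms] by (simp add: invol_meet invol_closed invol_invol join_comm)
  finally show ?thesis by simp
qed

lemma fibre_le_top:
  assumes "x \<in> fibre U c"
  shows "x \<sqsubseteq> invol U c"
  using join_left[of x "invol U x"] fibre_join_invol[OF assms] fibre_carrier[OF assms]
  by (simp add: invol_closed)

end

section \<open>The fibre as a finite Boolean algebra and its atoms\<close>

context distributive_sep_universe
begin

text \<open>With \<open>z = invol U (x \<squnion> y)\<close>, distributivity splits
  \<open>z \<sqinter> (x \<squnion> y)\<close> into \<open>z \<sqinter> x\<close> and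
  \<open>z \<sqinter> y\<close>. For \<open>w\<close> either of \<open>x\<close> and
  \<open>y\<close>, the meet \<open>z \<sqinter> w\<close> is squeezed between \<open>c\<close> and
  \<open>w \<sqinter> invol U w = c\<close>.\<close>

lemma fibre_join:
  assumes x: "x \<in> fibre U c" and y: "y \<in> fibre U c"
  shows "x \<squnion> y \<in> fibre U c"
proof -
  define z where "z = invol U x \<sqinter> invol U y"
  note xc = fibre_carrier[OF x] and yc = fibre_carrier[OF y]
  have ic: "invol U x \<in> carrier U" "invol U y \<in> carrier U"
    using xc yc by (auto simp: invol_closed)
  have zc: "z \<in> carrier U" and cc: "c \<in> carrier U"
    using ic fibre_bottom_carrier[OF x] by (auto simp: z_def)
  have zx: "z \<sqsubseteq> invol U x" and zy: "z \<sqsubseteq> invol U y"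
    unfolding z_def using ic by (auto intro: meet_left meet_right)
  have cz: "c \<sqsubseteq> z"
    unfolding z_def
    by (rule meet_le) (use ic cc x y in \<open>auto intro: fibre_bottom_le[OF invol_fibre]\<close>)
  have eq: "z \<sqinter> w = c" if w: "w \<in> fibre U c" and zw: "z \<sqsubseteq> invol U w" for w
  proof (rule le_antisym)
    note wc = fibre_carrier[OF w]
    have "z \<sqinter> w \<sqsubseteq> w \<sqinter> invol U w"
      using meet_le[OF meet_right[OF zc wc] le_trans[OF meet_left[OF zc wc] zw]] wc zc
      by (simp add: invol_closed)
    then show "z \<sqinter> w \<sqsubseteq> c" by (simp only: fibre_meet_invol[OF w])
    show "c \<sqsubseteq> z \<sqinter> w"
      using cz fibre_bottom_le[OF w] zc wc cc by (intro meet_le) auto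
  qed (use zc cc fibre_carrier[OF w] in auto)
  have "(x \<squnion> y) \<sqinter> invol U (x \<squnion> y) = z \<sqinter> (x \<squnion> y)"
    using xc yc by (simp add: invol_join z_def meet_comm)
  also have "\<dots> = c"
    \<comment> \<open>\<open>le_iff_meet\<close> characterises the order by joins; here it supplies
      \<open>c \<squnion> c = c\<close>.\<close>
    using xc yc zc cc eq[OF x zx] eq[OF y zy] le_iff_meet[of c c]
    by (simp add: meet_join_distrib)
  finally show ?thesis using xc yc by (simp add: fibre_def)
qed

lemma fibre_meet:
  assumes "x \<in> fibre U c" and "y \<in> fibre U c"
  shows "x \<sqinter> y \<in> fibre U c"
proof -
  have "x \<sqinter> y = invol U (invol U x \<squnion> invol U y)"
    using fibre_carrier[OF assms(1)] fibre_carrier[OF assms(2)]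
    by (simp add: invol_join invol_closed invol_invol)
  then show ?thesis using assms by (simp add: invol_fibre fibre_join)
qed

text \<open>For the third claim, \<open>a \<sqinter> x\<close> lies in the fibre and below the atom
  \<open>a\<close>, so it is \<open>a\<close> or \<open>c\<close>; the former would put
  \<open>a\<close> below \<open>x\<close>.\<close>

lemma fibre_atomsD:
  assumes "a \<in> fibre_atoms U c"
  shows "a \<in> fibre U c" "a \<noteq> c"
    and "\<And>x. x \<in> fibre U c \<Longrightarrow> \<not> a \<sqsubseteq> x \<Longrightarrow> a \<sqinter> x = c"
proof -
  show a: "a \<in> fibre U c" and "a \<noteq> c" using assms by (auto simp: fibre_atoms_def)
  fix x assume x: "x \<in> fibre U c" and nle: "\<not> a \<sqsubseteq> x"
  have "a \<sqinter> x \<sqsubseteq> a" using a x by (auto intro: meet_left fibre_carrier)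
  then have "a \<sqinter> x = a \<or> a \<sqinter> x = c"
    using assms fibre_meet[OF a x] by (auto simp: fibre_atoms_def)
  then show "a \<sqinter> x = c"
    using nle le_iff_join[of a x] fibre_carrier[OF a] fibre_carrier[OF x] by auto
qed

lemma atoms_below_meet:
  assumes "x \<in> fibre U c" "y \<in> fibre U c"
  shows "atoms_below U c (x \<sqinter> y) = atoms_below U c x \<inter> atoms_below U c y"
proof -
  have "a \<sqsubseteq> x \<sqinter> y \<longleftrightarrow> a \<sqsubseteq> x \<and> a \<sqsubseteq> y" if "a \<in> fibre_atoms U c" for a
  proof -
    note carr = fibre_carrier[OF assms(1)] fibre_carrier[OF assms(2)]
      fibre_carrier[OF fibre_atomsD(1)[OF that]]
    show ?thesis
      using carr meet_left[OF carr(1,2)] meet_right[OF carr(1,2)]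
      by (meson le_trans meet_closed meet_le)
  qed
  then show ?thesis by (auto simp: atoms_below_def)
qed

text \<open>Atoms are join-prime: if \<open>a\<close> were below neither \<open>x\<close> nor
  \<open>y\<close>, both meets would be \<open>c\<close>, and distributivity would force
  \<open>a = a \<sqinter> (x \<squnion> y) = c\<close>.\<close>

lemma atom_le_join_iff:
  assumes a: "a \<in> fibre_atoms U c" and x: "x \<in> fibre U c" and y: "y \<in> fibre U c"
  shows "a \<sqsubseteq> x \<squnion> y \<longleftrightarrow> a \<sqsubseteq> x \<or> a \<sqsubseteq> y"
proof
  note carr = fibre_carrier[OF x] fibre_carrier[OF y] fibre_carrier[OF fibre_atomsD(1)[OF a]]
  note cc = fibre_bottom_carrier[OF x]
  show "a \<sqsubseteq> x \<squnion> y" if "a \<sqsubseteq> x \<or> a \<sqsubseteq> y"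
    using that carr join_left[OF carr(1,2)] join_right[OF carr(1,2)]
    by (meson le_trans join_closed)
  show "a \<sqsubseteq> x \<or> a \<sqsubseteq> y" if le: "a \<sqsubseteq> x \<squnion> y"
  proof (rule ccontr)
    assume "\<not> (a \<sqsubseteq> x \<or> a \<sqsubseteq> y)"
    then have "a \<sqinter> x = c" "a \<sqinter> y = c" using fibre_atomsD(3)[OF a] x y by auto
    then have "a \<sqinter> (x \<squnion> y) = c"
      using carr cc le_iff_meet[of c c] by (simp add: meet_join_distrib)
    then show False
      using meet_eq_of_le[OF _ _ le] carr fibre_atomsD(2)[OF a] by simp
  qed
qed

lemma atoms_below_join:
  assumes "x \<in> fibre U c" "y \<in> fibre U c"
  shows "atoms_below U c (x \<squnion> y) = atoms_below U c x \<union> atoms_below U c y"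
  using atom_le_join_iff[OF _ assms] by (auto simp: atoms_below_def)

text \<open>Every atom lies below the top \<open>invol U c\<close>, which is
  \<open>x \<squnion> invol U x\<close>, so primeness puts it below one of the two. It cannot lie
  below both, since their meet is \<open>c\<close>.\<close>

lemma atoms_below_invol:
  assumes x: "x \<in> fibre U c"
  shows "atoms_below U c (invol U x) = fibre_atoms U c - atoms_below U c x"
proof -
  have "a \<sqsubseteq> invol U x \<longleftrightarrow> \<not> a \<sqsubseteq> x" if a: "a \<in> fibre_atoms U c" for a
  proof -
    note aF = fibre_atomsD(1)[OF a]
    note carr = fibre_carrier[OF x] fibre_carrier[OF aF] fibre_bottom_carrier[OF x]
    have "a \<sqsubseteq> x \<or> a \<sqsubseteq> invol U x"
      using fibre_le_top[OF aF] fibre_join_invol[OF x] atom_le_join_iff[OF a x invol_fibre[OF x]]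
      by simp
    moreover have False if "a \<sqsubseteq> x" "a \<sqsubseteq> invol U x"
    proof -
      have "a \<sqsubseteq> c"
        using meet_le[OF that] carr fibre_meet_invol[OF x] by (simp add: invol_closed)
      then show False
        using le_antisym[of a c] fibre_bottom_le[OF aF] carr fibre_atomsD(2)[OF a] by blast
    qed
    ultimately show ?thesis by blast
  qed
  then show ?thesis by (auto simp: atoms_below_def)
qed

lemma exists_atom_below:
  assumes "finite (carrier U)" and x: "x \<in> fibre U c" and "x \<noteq> c"
  shows "\<exists>a \<in> fibre_atoms U c. a \<sqsubseteq> x"
proof -
  define A where "A = {y \<in> fibre U c. y \<noteq> c \<and> y \<sqsubseteq> x}"
  have A: "A \<subseteq> carrier U" by (auto simp: A_def fibre_def)
  have "finite A" using finite_subset[OF A] assms(1) by blast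
  moreover have "x \<in> A" using assms(3) x fibre_carrier[OF x] by (auto simp: A_def)
  moreover have "asymp_on A (\<lambda>y z. y \<sqsubset> z)"
    using A by (auto simp: lless_eq intro!: asymp_onI)
  moreover have "transp_on A (\<lambda>y z. y \<sqsubset> z)"
    using lless_trans A by (intro transp_onI) (meson subsetD)
  ultimately obtain a where a: "a \<in> A" and min: "\<And>y. y \<in> A \<Longrightarrow> y \<noteq> a \<Longrightarrow> \<not> y \<sqsubset> a"
    using Finite_Set.bex_min_element[of A "\<lambda>y z. y \<sqsubset> z"] by blast
  \<comment> \<open>Minimality in \<open>A\<close> extends to the whole fibre, because anything
    below \<open>a\<close> is also below \<open>x\<close>.\<close>
  have "y = a \<or> y = c" if y: "y \<in> fibre U c" and "y \<sqsubseteq> a" for y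
  proof (rule ccontr)
    assume "\<not> (y = a \<or> y = c)"
    moreover have "y \<sqsubseteq> x"
      using le_trans[OF \<open>y \<sqsubseteq> a\<close>, of x] a y x A by (auto simp: A_def fibre_def)
    ultimately show False
      using min[of y] y \<open>y \<sqsubseteq> a\<close> by (auto simp: A_def lless_eq)
  qed
  then show ?thesis using a by (auto simp: A_def fibre_atoms_def)
qed

text \<open>The atoms determine the order. If the inclusion holds, no atom lies below
  \<open>x \<sqinter> invol U y\<close>, so this difference of \<open>x\<close> and \<open>y\<close>
  is the bottom \<open>c\<close>, which leaves only the part of \<open>x\<close> inside
  \<open>y\<close>.\<close>

lemma atoms_below_subset_iff:
  assumes fin: "finite (carrier U)" and x: "x \<in> fibre U c" and y: "y \<in> fibre U c"
  shows "atoms_below U c x \<subseteq> atoms_below U c y \<longleftrightarrow> x \<sqsubseteq> y"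
proof
  note carr = fibre_carrier[OF x] fibre_carrier[OF y] fibre_bottom_carrier[OF x]
  show "atoms_below U c x \<subseteq> atoms_below U c y" if "x \<sqsubseteq> y"
    using that atoms_below_meet[OF x y] meet_eq_of_le[OF carr(1,2)] by auto
  assume sub: "atoms_below U c x \<subseteq> atoms_below U c y"
  have xy: "x \<sqinter> invol U y \<in> fibre U c" by (intro fibre_meet x invol_fibre y)
  have "atoms_below U c (x \<sqinter> invol U y) = {}"
    using sub by (auto simp: atoms_below_meet atoms_below_invol x y invol_fibre)
  then have "x \<sqinter> invol U y = c"
    using exists_atom_below[OF fin xy] by (auto simp: atoms_below_def)
  \<comment> \<open>The join on the right is the top of the fibre; distributing splits
    \<open>x\<close> along \<open>y\<close> and its complement.\<close>
  moreover have "x = x \<sqinter> (y \<squnion> invol U y)"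
    using meet_eq_of_le[OF _ _ fibre_le_top[OF x]] carr fibre_join_invol[OF y]
    by (simp add: invol_closed)
  ultimately have "x = (x \<sqinter> y) \<squnion> c"
    using carr by (simp add: meet_join_distrib invol_closed)
  moreover have "(x \<sqinter> y) \<squnion> c \<sqsubseteq> y"
    using carr fibre_bottom_le[OF y] by (intro join_le meet_right) auto
  ultimately show "x \<sqsubseteq> y" by simp
qed

end

section \<open>Embedding the classes and their closure properties\<close>

lemma corner_faithful_embedding_atoms_below:
  assumes "distributive_sep_universe U" and fin: "finite (carrier U)" and "subsystem C U" and CF: "C \<subseteq> fibre U c"
  shows "corner_faithful_embedding U C (bipartition_universe (fibre_atoms U c)) (atoms_below U c)"
proof -
  interpret distributive_sep_universe U by fact
  let ?B = "bipartition_universe (fibre_atoms U c)" and ?f = "atoms_below U c"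
  have F: "x \<in> fibre U c" if "x \<in> C" for x using CF that by blast
  have sub: "?f x \<subseteq> fibre_atoms U c" for x by (auto simp: atoms_below_def)
  have invC: "invol U x \<in> C" if "x \<in> C" for x
    using that assms(3) by (auto simp: subsystem_def)
  have "inj_on ?f C"
  proof (rule inj_onI)
    fix x y assume x: "x \<in> C" and y: "y \<in> C" and "?f x = ?f y"
    then have "x \<sqsubseteq>\<^bsub>U\<^esub> y" "y \<sqsubseteq>\<^bsub>U\<^esub> x"
      using atoms_below_subset_iff[OF fin F[OF x] F[OF y]]
        atoms_below_subset_iff[OF fin F[OF y] F[OF x]] by auto
    then show "x = y"
      using le_antisym fibre_carrier[OF F[OF x]] fibre_carrier[OF F[OF y]] by blast
  qed
  then have "sep_iso (induced_system U C) (induced_system ?B (?f ` C)) ?f"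
    using F by (auto simp: sep_iso_def induced_system_def bipartition_universe_def
        bij_betw_def atoms_below_subset_iff[OF fin] atoms_below_invol)
  moreover have "subsystem (?f ` C) ?B"
    using sub invC F
    by (auto simp: subsystem_def bipartition_universe_def atoms_below_invol[symmetric])
  \<comment> \<open>Joins and meets are respected on the whole fibre, hence in particular for the
    corners that lie in \<open>C\<close>.\<close>
  ultimately show ?thesis
    using F by (auto simp: corner_faithful_embedding_def join_bipartition meet_bipartition sub
        atoms_below_join atoms_below_meet)
qed

lemma corner_closed_fibre:
  assumes "distributive_sep_universe U" and "subsystem S U"
  shows "corner_closed_subsystem (S \<inter> fibre U c) S U"
proof -
  interpret distributive_sep_universe U by fact
  show ?thesis
    using assms(2) fibre_join invol_fibre
    by (auto simp: corner_closed_subsystem_def subsystem_def)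
qed

text \<open>Whichever corner submodularity provides in \<open>S\<close> is also in the fibre, which
  contains both.\<close>

lemma submodular_fibre:
  assumes "distributive_sep_universe U" and "submodular_in S U"
  shows "submodular_in (S \<inter> fibre U c) U"
proof -
  interpret distributive_sep_universe U by fact
  show ?thesis
    using assms(2) fibre_join fibre_meet invol_fibre
    by (auto simp: submodular_in_def subsystem_def)
qed

theorem theorem3:
  fixes U :: "'a sep_system" and S :: "'a set"
  assumes "distributive_sep_universe U"
    and "finite (carrier U)"
    and "subsystem S U"
    and "submodular_in S U"
  shows "equiv S (same_bottom_rel U S)
    \<and> finite (S // same_bottom_rel U S)
    \<and> partition_on S (S // same_bottom_rel U S)
    \<and> (\<forall>C \<in> S // same_bottom_rel U S.
          corner_closed_subsystem C S U
        \<and> submodular_in C U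
        \<and> (\<exists>(V :: 'a set) f. corner_faithful_embedding U C (bipartition_universe V) f))"
proof -
  have "finite S" using assms(2,3) by (auto simp: subsystem_def intro: finite_subset)
  then have fin: "finite (S // same_bottom_rel U S)"
    by (rule finite_quotient) (auto simp: same_bottom_rel_def)
  have "corner_closed_subsystem C S U \<and> submodular_in C U
      \<and> (\<exists>(V :: 'a set) f. corner_faithful_embedding U C (bipartition_universe V) f)"
    if C: "C \<in> S // same_bottom_rel U S" for C
  proof -
    obtain c where c: "C = S \<inter> fibre U c"
      by (rule quotient_same_bottom_rel[OF assms(3) C])
    have cc: "corner_closed_subsystem C S U"
      unfolding c by (rule corner_closed_fibre[OF assms(1,3)])
    then have "subsystem C U" by (simp add: corner_closed_subsystem_def)
    \<comment> \<open>The ground set consists of atoms, which are elements of \<open>U\<close>; this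
      is why \<open>V\<close> can have type \<open>'a set\<close>.\<close>
    then have "corner_faithful_embedding U C (bipartition_universe (fibre_atoms U c)) (atoms_below U c)"
      by (rule corner_faithful_embedding_atoms_below[OF assms(1,2)]) (simp add: c)
    then show ?thesis
      using cc submodular_fibre[OF assms(1,4), of c] c by blast
  qed
  then show ?thesis
    using equiv_same_bottom_rel partition_on_quotient[OF equiv_same_bottom_rel] fin by blast
qed

end
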